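(* Let $\mathfrak{g}=\mathbb{R}^{4n}$ be the abelian Lie algebra with the flat hypersymplectic structure $(g,J_g,E_g)$ given by $$J_g=\begin{pmatrix}0&-\mathbb{1}_{2n}\\ \mathbb{1}_{2n}&0\end{pmatrix},\quad E_g=\begin{pmatrix}\mathbb{1}_{2n}&0\\ 0&-\mathbb{1}_{2n}\end{pmatrix},\quad g=\begin{pmatrix}0&0&0&I\\ 0&0&-I&0\\ 0&-I&0&0\\ I&0&0&0\end{pmatrix},$$ where $I$ is the $n\times n$ anti-diagonal matrix with all anti-diagonal entries equal to $1$ (and other entries $0$). Let $(\mathfrak{h},h,J_h,E_h)$ be an $s$-step nilpotent hypersymplectic Lie algebra, and let $k$ be an integer with $s\leq k\leq n$ and $k\geq2$. Let $A$ be a real $n\times n$ matrix which is nilpotent of step $k$ (i.e. $A^k=0$, $A^{k-1}\neq0$), and set $$N_{4n}=\begin{pmatrix}A&0&0&0\\ 0&-IA^\top I&0&0\\ 0&0&A&0\\ 0&0&0&-IA^\top I\end{pmatrix}.$$ Fix a basis $\{a_j\}$ of $\mathfrak{h}$ such that $[\mathfrak{h},\mathfrak{h}]\subset\mathrm{Span}\{a_j\mid j>1\}$, and define the representation $\varphi:\mathfrak{h}\to\mathrm{Der}(\mathfrak{g})$ by $\varphi(a_1)=N_{4n}$ and $\varphi(a_j)=0$ for $j>1$. Then $\tilde{\mathfrak{g}}=\mathfrak{g}\rtimes_\varphi\mathfrak{h}$, with $\tilde g=g\oplus h$, $\tilde J=J_g\oplus J_h$, $\tilde E=E_g\oplus E_h$,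 is a $k$-step nilpotent hypersymplectic Lie algebra of non-abelian type. Moreover, if $h$ is non-flat, then so is $\tilde g$.
   Context: A hypersymplectic Lie algebra is $(\mathfrak{g},g,J,E)$ where $\mathfrak{g}$ is a real finite-dimensional Lie algebra, $g$ a non-degenerate symmetric bilinear form, $J,E\in\mathrm{End}(\mathfrak{g})$, $J^2=-\mathrm{id}$, $E^2=\mathrm{id}$, $JE=-EJ$, $g(J\cdot,J\cdot)=g$, $g(E\cdot,E\cdot)=-g$, and both $J$ and $E$ are parallel for the Levi-Civita connection of $g$. It is of abelian type if $[JX,JY]=[X,Y]$ for all $X,Y$ (equivalently, $[EX,EY]=-[X,Y]$ for all $X,Y$), and of non-abelian type otherwise. Flat means that the curvature of the Levi-Civita connection vanishes. The semidirect product $\mathfrak{g}\rtimes_\varphi\mathfrak{h}$ is $\mathfrak{g}\oplus\mathfrak{h}$ with bracket $[X+A,Y+B]=[X,Y]+\varphi(A)Y-\varphi(B)X+[A,B]$. A Lie algebra is $k$-step nilpotent if its lower central series vanishes after exactly $k$ steps (abelian nonzero Lie algebras are $1$-step nilpotent). *)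

theory Defs
  imports "HOL-Analysis.Analysis"
begin

subsection \<open>Real finite-dimensional Lie algebras\<close>

definition finite_dim :: "'a::real_vector itself \<Rightarrow> bool" where
  "finite_dim _ \<longleftrightarrow> (\<exists>B::'a set. finite B \<and> span B = UNIV)"

definition lie_algebra :: "('a::real_vector \<Rightarrow> 'a \<Rightarrow> 'a) \<Rightarrow> bool" where
  "lie_algebra br \<longleftrightarrow> finite_dim TYPE('a) \<and> bilinear br \<and> (\<forall>x. br x x = 0) \<and>
     (\<forall>x y z. br x (br y z) + br y (br z x) + br z (br x y) = 0)"

primrec lower_central :: "('a::real_vector \<Rightarrow> 'a \<Rightarrow> 'a) \<Rightarrow> nat \<Rightarrow> 'a set" where
  "lower_central br 0 = UNIV"
| "lower_central br (Suc i) = span {br x y | x y. y \<in> lower_central br i}"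

definition nilpotent_step :: "('a::real_vector \<Rightarrow> 'a \<Rightarrow> 'a) \<Rightarrow> nat \<Rightarrow> bool" where
  "nilpotent_step br k \<longleftrightarrow>
     lower_central br k = {0} \<and> (\<forall>i<k. lower_central br i \<noteq> {0})"

definition derivation :: "('a::real_vector \<Rightarrow> 'a \<Rightarrow> 'a) \<Rightarrow> ('a \<Rightarrow> 'a) \<Rightarrow> bool" where
  "derivation br D \<longleftrightarrow> linear D \<and> (\<forall>x y. D (br x y) = br (D x) y + br x (D y))"

definition rep_by_derivations ::
  "('a::real_vector \<Rightarrow> 'a \<Rightarrow> 'a) \<Rightarrow> ('b::real_vector \<Rightarrow> 'b \<Rightarrow> 'b) \<Rightarrow> ('b \<Rightarrow> 'a \<Rightarrow> 'a) \<Rightarrow> bool" where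
  "rep_by_derivations brg brh \<phi> \<longleftrightarrow>
     bilinear \<phi> \<and> (\<forall>a. derivation brg (\<phi> a)) \<and>
     (\<forall>a b x. \<phi> (brh a b) x = \<phi> a (\<phi> b x) - \<phi> b (\<phi> a x))"

definition semidirect_bracket ::
  "('a::real_vector \<Rightarrow> 'a \<Rightarrow> 'a) \<Rightarrow> ('b::real_vector \<Rightarrow> 'b \<Rightarrow> 'b) \<Rightarrow> ('b \<Rightarrow> 'a \<Rightarrow> 'a)
    \<Rightarrow> 'a \<times> 'b \<Rightarrow> 'a \<times> 'b \<Rightarrow> 'a \<times> 'b" where
  "semidirect_bracket brg brh \<phi> = (\<lambda>(x, a) (y, b).
     (brg x y + \<phi> a y - \<phi> b x, brh a b))"

subsection \<open>Metrics and the Levi-Civita connection\<close>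

definition metric :: "('a::real_vector \<Rightarrow> 'a \<Rightarrow> real) \<Rightarrow> bool" where
  "metric g \<longleftrightarrow> bilinear g \<and> (\<forall>x y. g x y = g y x) \<and> (\<forall>x. (\<forall>y. g x y = 0) \<longrightarrow> x = 0)"

definition torsion_free_metric_connection ::
  "('a::real_vector \<Rightarrow> 'a \<Rightarrow> 'a) \<Rightarrow> ('a \<Rightarrow> 'a \<Rightarrow> real) \<Rightarrow> ('a \<Rightarrow> 'a \<Rightarrow> 'a) \<Rightarrow> bool" where
  "torsion_free_metric_connection br g D \<longleftrightarrow> bilinear D \<and>
     (\<forall>x y. D x y - D y x = br x y) \<and>
     (\<forall>x y z. g (D x y) z + g y (D x z) = 0)"

definition levi_civita ::
  "('a::real_vector \<Rightarrow> 'a \<Rightarrow> 'a) \<Rightarrow> ('a \<Rightarrow> 'a \<Rightarrow> real) \<Rightarrow> 'a \<Rightarrow> 'a \<Rightarrow> 'a" where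
  "levi_civita br g = (THE D. torsion_free_metric_connection br g D)"

definition parallel :: "('a::real_vector \<Rightarrow> 'a \<Rightarrow> 'a) \<Rightarrow> ('a \<Rightarrow> 'a) \<Rightarrow> bool" where
  "parallel D T \<longleftrightarrow> (\<forall>x y. D x (T y) = T (D x y))"

definition curvature ::
  "('a::real_vector \<Rightarrow> 'a \<Rightarrow> 'a) \<Rightarrow> ('a \<Rightarrow> 'a \<Rightarrow> 'a) \<Rightarrow> 'a \<Rightarrow> 'a \<Rightarrow> 'a \<Rightarrow> 'a" where
  "curvature br D x y z = D x (D y z) - D y (D x z) - D (br x y) z"

definition flat_metric :: "('a::real_vector \<Rightarrow> 'a \<Rightarrow> 'a) \<Rightarrow> ('a \<Rightarrow> 'a \<Rightarrow> real) \<Rightarrow> bool" where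
  "flat_metric br g \<longleftrightarrow> (\<forall>x y z. curvature br (levi_civita br g) x y z = 0)"

text \<open>On a Lie algebra with a metric there is exactly one torsion-free metric connection
  (Koszul formula), so the definite description in \<^const>\<open>levi_civita\<close> denotes it;
  see \<open>levi_civita_exists_unique\<close> below.\<close>

lemma metric_representable:
  fixes g :: "'a::real_vector \<Rightarrow> 'a \<Rightarrow> real"
  assumes fd: "finite_dim TYPE('a)" and g: "metric g" and f: "linear f"
  shows "\<exists>x. \<forall>z. g x z = f z"
proof -
  obtain B0 :: "'a set" where B0: "finite B0" "span B0 = UNIV"
    using fd unfolding finite_dim_def by blast
  obtain B :: "'a set" where B: "B \<subseteq> B0" "independent B" "B0 \<subseteq> span B"
    using maximal_independent_subset by blast
  have fB: "finite B" using B B0 finite_subset by blast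
  have sB: "span B = UNIV" using B B0 by (metis span_mono span_span top.extremum_uniqueI)
  interpret fdv: finite_dimensional_vector_space "scaleR :: real \<Rightarrow> 'a \<Rightarrow> 'a" B
    using fB B(2) sB
    by unfold_locales (auto simp: dependent_raw_def span_raw_def)
  have bl: "bilinear g" and nd: "\<And>x. (\<forall>y. g x y = 0) \<Longrightarrow> x = 0"
    using g unfolding metric_def by blast+
  have lin1: "linear (g x)" and lin2: "linear (\<lambda>x. g x y)" for x y
    using bl unfolding bilinear_def by blast+
  have eqB: "h = h'" if "linear h" "linear h'" "\<And>b. b \<in> B \<Longrightarrow> h b = h' b"
    for h h' :: "'a \<Rightarrow> real"
    using linear_eq_on[OF that(1,2)] that(3) sB by blast
  define T where "T x = (\<Sum>b\<in>B. g x b *\<^sub>R b)" for x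
  have linT: "linear T"
    unfolding T_def
    by (intro linear_compose_sum ballI linearI)
       (simp_all add: bilinear_ladd[OF bl] bilinear_lmul[OF bl] algebra_simps)
  have indep: "u b = v b" if "(\<Sum>b\<in>B. u b *\<^sub>R b) = (\<Sum>b\<in>B. v b *\<^sub>R b)" "b \<in> B"
    for u v :: "'a \<Rightarrow> real" and b
  proof -
    have "(\<Sum>b\<in>B. (u b - v b) *\<^sub>R b) = 0"
      using that(1) by (simp add: scaleR_diff_left sum_subtractf)
    then have "u b - v b = 0"
      using independentD[OF B(2) fB subset_refl, of "\<lambda>b. u b - v b" b] that(2) by blast
    then show ?thesis by simp
  qed
  have "inj T"
    unfolding linear_injective_0[OF linT]
  proof (intro allI impI)
    fix x assume "T x = 0"
    then have "(\<Sum>b\<in>B. g x b *\<^sub>R b) = (\<Sum>b\<in>B. 0 *\<^sub>R b)" by (simp add: T_def)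
    from indep[OF this] have "g x = (\<lambda>_. 0)"
      by (intro eqB lin1) (auto simp: linear_iff)
    then show "x = 0" using nd by metis
  qed
  then have "surj T"
    using fdv.linear_inj_imp_surj linT unfolding linear_def by blast
  then obtain x where "T x = (\<Sum>b\<in>B. f b *\<^sub>R b)" by (metis surjD)
  from indep[OF this[unfolded T_def]] have "g x = f" by (intro eqB lin1 f)
  then show ?thesis by blast
qed

lemma levi_civita_exists_unique:
  fixes br :: "'a::real_vector \<Rightarrow> 'a \<Rightarrow> 'a"
  assumes L: "lie_algebra br" and g: "metric g"
  shows "\<exists>!D. torsion_free_metric_connection br g D"
proof -
  have fd: "finite_dim TYPE('a)" and bb: "bilinear br" and alt: "\<And>x. br x x = 0"
    using L unfolding lie_algebra_def by blast+
  have bl: "bilinear g" and sym: "\<And>x y. g x y = g y x"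
    and nd: "\<And>x. (\<forall>y. g x y = 0) \<Longrightarrow> x = 0"
    using g unfolding metric_def by blast+
  note lins = bilinear_ladd[OF bl] bilinear_radd[OF bl] bilinear_lmul[OF bl] bilinear_rmul[OF bl]
    bilinear_lsub[OF bl] bilinear_rsub[OF bl] bilinear_lneg[OF bl] bilinear_rneg[OF bl]
    bilinear_ladd[OF bb] bilinear_radd[OF bb] bilinear_lmul[OF bb] bilinear_rmul[OF bb]
  have skew: "br y x = - br x y" for x y
    using alt[of "x + y"] alt[of x] alt[of y]
    by (simp add: lins eq_neg_iff_add_eq_0 add.commute)
  have ext: "x = y" if "\<And>z. g x z = g y z" for x y
    using nd[of "x - y"] that by (simp add: lins)
  define K where "K x y z = (g (br x y) z - g (br y z) x + g (br z x) y) / 2" for x y z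
  have "\<exists>w. \<forall>z. g w z = K x y z" for x y
    by (rule metric_representable[OF fd g])
       (auto simp: linear_iff K_def lins field_simps)
  then obtain D where D: "\<And>x y z. g (D x y) z = K x y z" by metis
  have bD: "bilinear D"
    unfolding bilinear_def linear_iff
    by (intro conjI allI; rule ext) (simp_all add: lins D K_def field_simps)
  have tD: "D x y - D y x = br x y" for x y
  proof (rule ext)
    fix z show "g (D x y - D y x) z = g (br x y) z"
      using skew[of x y] skew[of z x] skew[of z y] by (simp add: lins D K_def field_simps)
  qed
  have mD: "g (D x y) z + g y (D x z) = 0" for x y z
    unfolding sym[of y "D x z"] D K_def
    using skew[of y z] skew[of x z] skew[of x y] by (simp add: lins field_simps)
  have "torsion_free_metric_connection br g D"
    unfolding torsion_free_metric_connection_def using bD tD mD by blast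
  moreover have "D' = D" if "torsion_free_metric_connection br g D'" for D'
  proof (intro HOL.ext ext)
    fix x y z
    have t: "br x y = D' x y - D' y x" for x y
      using that unfolding torsion_free_metric_connection_def by auto
    have m: "g (D' x y) z + g y (D' x z) = 0" for x y z
      using that unfolding torsion_free_metric_connection_def by auto
    show "g (D' x y) z = g (D x y) z"
      unfolding D K_def t
      using m[of x y z] m[of y x z] m[of z x y]
        sym[of y "D' x z"] sym[of x "D' y z"] sym[of x "D' z y"]
      by (simp add: lins field_simps)
  qed
  ultimately show ?thesis by blast
qed

subsection \<open>Hypersymplectic Lie algebras\<close>

definition hypersymplectic ::
  "('a::real_vector \<Rightarrow> 'a \<Rightarrow> 'a) \<Rightarrow> ('a \<Rightarrow> 'a \<Rightarrow> real) \<Rightarrow> ('a \<Rightarrow> 'a) \<Rightarrow> ('a \<Rightarrow> 'a) \<Rightarrow> bool" where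
  "hypersymplectic br g J E \<longleftrightarrow>
     lie_algebra br \<and> metric g \<and> linear J \<and> linear E \<and>
     (\<forall>x. J (J x) = - x) \<and> (\<forall>x. E (E x) = x) \<and> (\<forall>x. J (E x) = - E (J x)) \<and>
     (\<forall>x y. g (J x) (J y) = g x y) \<and> (\<forall>x y. g (E x) (E y) = - g x y) \<and>
     parallel (levi_civita br g) J \<and> parallel (levi_civita br g) E"

definition abelian_type :: "('a \<Rightarrow> 'a \<Rightarrow> 'a) \<Rightarrow> ('a \<Rightarrow> 'a) \<Rightarrow> bool" where
  "abelian_type br J \<longleftrightarrow> (\<forall>x y. br (J x) (J y) = br x y)"

definition sum_metric ::
  "('a \<Rightarrow> 'a \<Rightarrow> real) \<Rightarrow> ('b \<Rightarrow> 'b \<Rightarrow> real) \<Rightarrow> 'a \<times> 'b \<Rightarrow> 'a \<times> 'b \<Rightarrow> real" where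
  "sum_metric g h = (\<lambda>(x, a) (y, b). g x y + h a b)"

subsection \<open>Block matrices\<close>

definition block4 ::
  "'a^'m^'k \<Rightarrow> 'a^'n^'k \<Rightarrow> 'a^'m^'l \<Rightarrow> 'a^'n^'l \<Rightarrow> 'a^('m + 'n)^('k + 'l)" where
  "block4 P Q R S = (\<chi> i j. case i of
       Inl i' \<Rightarrow> (case j of Inl j' \<Rightarrow> P $ i' $ j' | Inr j' \<Rightarrow> Q $ i' $ j')
     | Inr i' \<Rightarrow> (case j of Inl j' \<Rightarrow> R $ i' $ j' | Inr j' \<Rightarrow> S $ i' $ j'))"

(* The built-in power on 'a^'n^'n would be taken entrywise. *)
primrec mat_pow :: "real^'n^'n \<Rightarrow> nat \<Rightarrow> real^'n^'n" where
  "mat_pow A 0 = mat 1"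
| "mat_pow A (Suc k) = A ** mat_pow A k"

(* The index type plays the role of {1..n} via its linear order; i and j are opposite when the
   number of indices below i equals the number of indices above j. *)
definition antidiag :: "real^('n::{finite,linorder})^('n::{finite,linorder})" where
  "antidiag = (\<chi> i j. if card {k. k < i} = card {k. j < k} then 1 else 0)"

type_synonym 'n quad = "('n + 'n) + ('n + 'n)"

definition J_mat :: "real^('n::finite quad)^('n quad)" where
  "J_mat = block4 0 (- mat 1) (mat 1) 0"

definition E_mat :: "real^('n::finite quad)^('n quad)" where
  "E_mat = block4 (mat 1) 0 0 (- mat 1)"

definition g_mat :: "real^('n::{finite,linorder} quad)^('n quad)" where
  "g_mat = block4 0 (block4 0 antidiag (- antidiag) 0) (block4 0 (- antidiag) antidiag 0) 0"

definition N_mat :: "real^('n::{finite,linorder})^('n::{finite,linorder}) \<Rightarrow> real^('n quad)^('n quad)" where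
  "N_mat A = (let P = block4 A 0 0 (- (antidiag ** transpose A ** antidiag)) in block4 P 0 0 P)"

definition form_of :: "real^'m^'m \<Rightarrow> real^'m \<Rightarrow> real^'m \<Rightarrow> real" where
  "form_of G x y = x \<bullet> (G *v y)"

end

theory Submission
  imports Defs
begin

text \<open>
  Everything rests on one formula. Let \<open>\<phi>\<close> be a representation of \<open>\<hh>\<close> on \<open>\<gg>\<close> by derivations that
  are skew for \<open>g\<close>. Then the Levi-Civita connection of \<open>g \<oplus> h\<close> on the semidirect product is
  \<open>\<nabla>\<^bsub>(x,a)\<^esub> (y,b) = (\<nabla>\<^sup>g\<^sub>x y + \<phi>(a) y, \<nabla>\<^sup>h\<^sub>a b)\<close>,
  because the right-hand side is metric and torsion free (lemma \<open>levi_civita_semidirect\<close>).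
  If \<open>\<phi>(a)\<close> commutes with the complex and the product structure of \<open>\<gg>\<close>, these and those of \<open>\<hh>\<close>
  are therefore parallel together, which makes the product hypersymplectic; and the second component of
  the curvature is the curvature of \<open>h\<close>, so that flatness passes from the product to \<open>h\<close>.

  In the case at hand \<open>\<phi>(a) = c(a) N\<close> for a linear form \<open>c\<close> that vanishes on \<open>[\<hh>, \<hh>]\<close> and takes the
  value 1 at the first basis vector. Bracketing repeatedly with that vector shows that the \<open>i\<close>-th term of
  the lower central series contains \<open>N\<^sup>i \<gg> \<times> 0\<close>, and because \<open>c\<close> kills commutators it is contained
  in \<open>N\<^sup>i \<gg> \<times> \<hh>\<^sub>i\<close>, where \<open>\<hh>\<^sub>i\<close> is the \<open>i\<close>-th term of the series of \<open>\<hh>\<close>; as \<open>s \<le> k\<close>,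
  this gives the nilpotency step (lemma \<open>nilpotent_step_semidirect_form\<close>). Abelian type would force
  \<open>N = t N J\<close> for a real number \<open>t\<close>, hence \<open>N = - t\<^sup>2 N\<close> and \<open>N = 0\<close>
  (lemma \<open>not_abelian_type_semidirect_form\<close>).

  What remains are identities between block matrices. They all follow from the multiplication rule for
  blocks and from the fact that the antidiagonal matrix is a symmetric involution. In particular the block
  \<open>- I A\<^sup>T I\<close> is the negative of the adjoint of \<open>A\<close> for the pairing given by \<open>I\<close>, which is why \<open>N\<close> is
  skew for \<open>g\<close> and why \<open>N\<close> and \<open>A\<close> have the same nilpotency step.
\<close>

section \<open>Semidirect products\<close>

lemma finite_dim_euclidean: "finite_dim TYPE('a::euclidean_space)"
  unfolding finite_dim_def using finite_Basis span_Basis by blast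

lemma finite_dim_prod:
  assumes "finite_dim TYPE('a::real_vector)" and "finite_dim TYPE('b::real_vector)"
  shows "finite_dim TYPE('a \<times> 'b)"
proof -
  obtain B :: "'a set" and C :: "'b set"
    where B: "finite B" "span B = UNIV" and C: "finite C" "span C = UNIV"
    using assms unfolding finite_dim_def by blast
  let ?S = "(\<lambda>x. (x, 0::'b)) ` B \<union> (\<lambda>y. (0::'a, y)) ` C"
  have l1: "linear (\<lambda>x. (x, 0::'b))" and l2: "linear (\<lambda>y. (0::'a, y))"
    by (auto simp: linear_iff)
  have x: "(x, 0) \<in> span ?S" for x
  proof -
    have "(x, 0) \<in> span ((\<lambda>x. (x, 0::'b)) ` B)"
      unfolding linear_span_image[OF l1] B(2) by (rule rangeI)
    then show ?thesis by (rule span_mono[THEN subsetD, rotated]) (rule Un_upper1)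
  qed
  have y: "(0, y) \<in> span ?S" for y
  proof -
    have "(0, y) \<in> span ((\<lambda>y. (0::'a, y)) ` C)"
      unfolding linear_span_image[OF l2] C(2) by (rule rangeI)
    then show ?thesis by (rule span_mono[THEN subsetD, rotated]) (rule Un_upper2)
  qed
  have "(x, y) \<in> span ?S" for x y
    using span_add[OF x[of x] y[of y]] by simp
  then have "span ?S = UNIV" by auto
  moreover have "finite ?S" using B(1) C(1) by simp
  ultimately show ?thesis unfolding finite_dim_def by (intro exI[of _ ?S]) simp
qed

lemma bilinear_lins:
  assumes "bilinear f"
  shows "f (x + x') y = f x y + f x' y" "f x (y + y') = f x y + f x y'"
    "f (r *\<^sub>R x) y = r *\<^sub>R f x y" "f x (r *\<^sub>R y) = r *\<^sub>R f x y"
    "f (x - x') y = f x y - f x' y" "f x (y - y') = f x y - f x y'"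
    "f (- x) y = - f x y" "f x (- y) = - f x y" "f 0 y = 0" "f x 0 = 0"
  using assms by (simp_all add: bilinear_ladd bilinear_radd bilinear_lmul bilinear_rmul
      bilinear_lsub bilinear_rsub bilinear_lneg bilinear_rneg bilinear_lzero bilinear_rzero)

lemma lie_algebra_skew:
  assumes "lie_algebra br"
  shows "br x y = - br y x"
proof -
  have b: "bilinear br" and alt: "\<And>x. br x x = 0"
    using assms unfolding lie_algebra_def by blast+
  show ?thesis
    using alt[of "x + y"] alt[of x] alt[of y]
    by (simp add: bilinear_lins[OF b] eq_neg_iff_add_eq_0 add.commute)
qed

lemma lie_algebra_semidirect:
  fixes brg :: "'a::real_vector \<Rightarrow> 'a \<Rightarrow> 'a" and brh :: "'b::real_vector \<Rightarrow> 'b \<Rightarrow> 'b"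
  assumes g: "lie_algebra brg" and h: "lie_algebra brh" and r: "rep_by_derivations brg brh \<phi>"
  shows "lie_algebra (semidirect_bracket brg brh \<phi>)"
proof -
  have bg: "bilinear brg" and ag: "\<And>x. brg x x = 0"
    and jg: "\<And>x y z. brg x (brg y z) + brg y (brg z x) + brg z (brg x y) = 0"
    using g unfolding lie_algebra_def by blast+
  have bh: "bilinear brh" and ah: "\<And>x. brh x x = 0"
    and jh: "\<And>x y z. brh x (brh y z) + brh y (brh z x) + brh z (brh x y) = 0"
    using h unfolding lie_algebra_def by blast+
  have bp: "bilinear \<phi>" and dp: "\<And>a x y. \<phi> a (brg x y) = brg (\<phi> a x) y + brg x (\<phi> a y)"
    and hp: "\<And>a b x. \<phi> (brh a b) x = \<phi> a (\<phi> b x) - \<phi> b (\<phi> a x)"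
    using r unfolding rep_by_derivations_def derivation_def by blast+
  note lins = bilinear_lins[OF bg] bilinear_lins[OF bh] bilinear_lins[OF bp]
  let ?br = "semidirect_bracket brg brh \<phi>"
  have "bilinear ?br"
    unfolding bilinear_def linear_iff
    by (auto simp: semidirect_bracket_def lins algebra_simps)
  moreover have "?br x x = 0" for x
    by (cases x) (simp add: semidirect_bracket_def ag ah zero_prod_def)
  moreover have "?br u (?br v w) + ?br v (?br w u) + ?br w (?br u v) = 0" for u v w
  proof (cases u, cases v, cases w)
    fix x a y b z c assume [simp]: "u = (x, a)" "v = (y, b)" "w = (z, c)"
    have sk: "brg (\<phi> s p) q = - brg q (\<phi> s p)" for s p q
      by (rule lie_algebra_skew[OF g])
    have "fst (?br u (?br v w) + ?br v (?br w u) + ?br w (?br u v)) =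
        brg x (brg y z) + brg y (brg z x) + brg z (brg x y)"
      by (simp add: semidirect_bracket_def, simp only: lins hp dp, simp only: sk lins)
        (simp add: algebra_simps)
    moreover have "snd (?br u (?br v w) + ?br v (?br w u) + ?br w (?br u v)) =
        brh a (brh b c) + brh b (brh c a) + brh c (brh a b)"
      by (simp add: semidirect_bracket_def)
    ultimately show ?thesis by (simp add: prod_eq_iff jg jh)
  qed
  moreover have "finite_dim TYPE('a \<times> 'b)"
    using g h by (intro finite_dim_prod) (simp_all add: lie_algebra_def)
  ultimately show ?thesis unfolding lie_algebra_def by simp
qed

lemma metric_sum:
  assumes g: "metric g" and h: "metric h"
  shows "metric (sum_metric g h)"
proof -
  have bg: "bilinear g" and sg: "\<And>x y. g x y = g y x" and ng: "\<And>x. (\<forall>y. g x y = 0) \<Longrightarrow> x = 0"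
    using g unfolding metric_def by blast+
  have bh: "bilinear h" and sh: "\<And>x y. h x y = h y x" and nh: "\<And>x. (\<forall>y. h x y = 0) \<Longrightarrow> x = 0"
    using h unfolding metric_def by blast+
  note lins = bilinear_lins[OF bg] bilinear_lins[OF bh]
  have "bilinear (sum_metric g h)"
    unfolding bilinear_def linear_iff by (auto simp: sum_metric_def lins algebra_simps)
  moreover have "sum_metric g h x y = sum_metric g h y x" for x y
    by (cases x; cases y) (simp add: sum_metric_def sg sh)
  moreover have "u = 0" if u: "\<forall>v. sum_metric g h u v = 0" for u
  proof -
    have "fst u = 0"
    proof (intro ng allI)
      fix y show "g (fst u) y = 0"
        using u[rule_format, of "(y, 0)"] by (cases u) (simp add: sum_metric_def lins)
    qed
    moreover have "snd u = 0"
    proof (intro nh allI)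
      fix y show "h (snd u) y = 0"
        using u[rule_format, of "(0, y)"] by (cases u) (simp add: sum_metric_def lins)
    qed
    ultimately show ?thesis by (simp add: prod_eq_iff)
  qed
  ultimately show ?thesis unfolding metric_def by simp
qed

section \<open>The Levi-Civita connection of a semidirect product\<close>

lemma levi_civita_eqI:
  assumes "lie_algebra br" and "metric g" and "torsion_free_metric_connection br g D"
  shows "levi_civita br g = D"
  unfolding levi_civita_def
  using levi_civita_exists_unique[OF assms(1,2)] assms(3)
  by (rule the1_equality[of "torsion_free_metric_connection br g" D])

lemma torsion_free_metric_connection_levi_civita:
  assumes "lie_algebra br" and "metric g"
  shows "torsion_free_metric_connection br g (levi_civita br g)"
  unfolding levi_civita_def
  by (rule theI'[OF levi_civita_exists_unique[OF assms]])

text \<open>The terms \<open>\<phi>(a) y\<close> account for the mixed bracket \<open>\<phi>(a) y - \<phi>(b) x\<close>, so the torsion vanishes;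
  skewness of \<open>\<phi>(a)\<close> is what keeps the connection metric.\<close>

lemma levi_civita_semidirect:
  assumes g: "lie_algebra brg" "metric g" and h: "lie_algebra brh" "metric h"
    and r: "rep_by_derivations brg brh \<phi>"
    and skew: "\<And>a x y. g (\<phi> a x) y + g x (\<phi> a y) = 0"
  shows "levi_civita (semidirect_bracket brg brh \<phi>) (sum_metric g h) =
    (\<lambda>(x, a) (y, b). (levi_civita brg g x y + \<phi> a y, levi_civita brh h a b))"
    (is "_ = ?D")
proof (rule levi_civita_eqI)
  show "lie_algebra (semidirect_bracket brg brh \<phi>)"
    by (rule lie_algebra_semidirect[OF g(1) h(1) r])
  show "metric (sum_metric g h)" by (rule metric_sum[OF g(2) h(2)])
  have bm: "bilinear g" using g(2) unfolding metric_def by blast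
  have bp: "bilinear \<phi>" using r unfolding rep_by_derivations_def by blast
  note Dg = torsion_free_metric_connection_levi_civita[OF g]
  note Dh = torsion_free_metric_connection_levi_civita[OF h]
  have bg: "bilinear (levi_civita brg g)"
    and tg: "\<And>x y. brg x y = levi_civita brg g x y - levi_civita brg g y x"
    and mg: "\<And>x y z. g (levi_civita brg g x y) z + g y (levi_civita brg g x z) = 0"
    using Dg unfolding torsion_free_metric_connection_def by auto
  have bh: "bilinear (levi_civita brh h)"
    and th: "\<And>x y. brh x y = levi_civita brh h x y - levi_civita brh h y x"
    and mh: "\<And>x y z. h (levi_civita brh h x y) z + h y (levi_civita brh h x z) = 0"
    using Dh unfolding torsion_free_metric_connection_def by auto
  note lins = bilinear_lins[OF bg] bilinear_lins[OF bh] bilinear_lins[OF bp]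
  have bD: "bilinear ?D"
    unfolding bilinear_def linear_iff by (auto simp: lins algebra_simps)
  have tD: "?D u v - ?D v u = semidirect_bracket brg brh \<phi> u v" for u v
    by (cases u; cases v) (simp add: semidirect_bracket_def tg th)
  have mD: "sum_metric g h (?D u v) w + sum_metric g h v (?D u w) = 0" for u v w
  proof (cases u, cases v, cases w)
    fix x a y b z c assume [simp]: "u = (x, a)" "v = (y, b)" "w = (z, c)"
    show ?thesis
      using mg[of x y z] mh[of a b c] skew[of a y z]
      by (simp add: sum_metric_def bilinear_lins[OF bm])
  qed
  show "torsion_free_metric_connection (semidirect_bracket brg brh \<phi>) (sum_metric g h) ?D"
    unfolding torsion_free_metric_connection_def by (intro conjI allI bD tD mD)
qed

lemma parallel_semidirect:
  fixes brg :: "'a::real_vector \<Rightarrow> 'a \<Rightarrow> 'a" and brh :: "'b::real_vector \<Rightarrow> 'b \<Rightarrow> 'b"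
  assumes g: "lie_algebra brg" "metric g" and h: "lie_algebra brh" "metric h"
    and r: "rep_by_derivations brg brh \<phi>"
    and skew: "\<And>a x y. g (\<phi> a x) y + g x (\<phi> a y) = 0"
    and T: "linear T" "\<And>a x. \<phi> a (T x) = T (\<phi> a x)"
    and par: "parallel (levi_civita brg g) T" "parallel (levi_civita brh h) T'"
  shows "parallel (levi_civita (semidirect_bracket brg brh \<phi>) (sum_metric g h)) (map_prod T T')"
  unfolding parallel_def
proof (intro allI)
  fix u v :: "'a \<times> 'b"
  obtain x a y b where uv: "u = (x, a)" "v = (y, b)" by (cases u; cases v)
  have p: "levi_civita brg g x (T y) = T (levi_civita brg g x y)"
    "levi_civita brh h a (T' b) = T' (levi_civita brh h a b)"
    using par unfolding parallel_def by simp_all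
  show "levi_civita (semidirect_bracket brg brh \<phi>) (sum_metric g h) u (map_prod T T' v) =
      map_prod T T' (levi_civita (semidirect_bracket brg brh \<phi>) (sum_metric g h) u v)"
    by (simp only: levi_civita_semidirect[OF g h r, OF skew] uv map_prod_simp prod.case p T(2)
        linear_add[OF T(1)])
qed

lemma linear_map_prod:
  assumes "linear f" and "linear g"
  shows "linear (map_prod f g)"
  by (rule linearI)
    (simp_all add: prod_eq_iff linear_add[OF assms(1)] linear_add[OF assms(2)]
      linear_cmul[OF assms(1)] linear_cmul[OF assms(2)])

lemma hypersymplectic_semidirect:
  assumes g: "hypersymplectic brg g J E" and h: "hypersymplectic brh h J' E'"
    and r: "rep_by_derivations brg brh \<phi>"
    and skew: "\<And>a x y. g (\<phi> a x) y + g x (\<phi> a y) = 0"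
    and comm: "\<And>a x. \<phi> a (J x) = J (\<phi> a x)" "\<And>a x. \<phi> a (E x) = E (\<phi> a x)"
  shows "hypersymplectic (semidirect_bracket brg brh \<phi>) (sum_metric g h)
    (map_prod J J') (map_prod E E')"
proof -
  have lg: "lie_algebra brg" and mg: "metric g" and linJ: "linear J" and linE: "linear E"
    and pg: "parallel (levi_civita brg g) J" "parallel (levi_civita brg g) E"
    and ag: "\<forall>x. J (J x) = - x" "\<forall>x. E (E x) = x" "\<forall>x. J (E x) = - E (J x)"
      "\<forall>x y. g (J x) (J y) = g x y" "\<forall>x y. g (E x) (E y) = - g x y"
    using g unfolding hypersymplectic_def by blast+
  have lh: "lie_algebra brh" and mh: "metric h" and linJ': "linear J'" and linE': "linear E'"
    and ph: "parallel (levi_civita brh h) J'" "parallel (levi_civita brh h) E'"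
    and ah: "\<forall>x. J' (J' x) = - x" "\<forall>x. E' (E' x) = x" "\<forall>x. J' (E' x) = - E' (J' x)"
      "\<forall>x y. h (J' x) (J' y) = h x y" "\<forall>x y. h (E' x) (E' y) = - h x y"
    using h unfolding hypersymplectic_def by blast+
  have lin: "linear (map_prod J J')" "linear (map_prod E E')"
    by (intro linear_map_prod linJ linJ' linE linE')+
  note par = parallel_semidirect[OF lg mg lh mh r, OF skew]
  show ?thesis
    unfolding hypersymplectic_def
  proof (intro conjI)
    show "lie_algebra (semidirect_bracket brg brh \<phi>)" by (rule lie_algebra_semidirect[OF lg lh r])
    show "metric (sum_metric g h)" by (rule metric_sum[OF mg mh])
    show "parallel (levi_civita (semidirect_bracket brg brh \<phi>) (sum_metric g h)) (map_prod J J')"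
      by (rule par[OF linJ comm(1) pg(1) ph(1)])
    show "parallel (levi_civita (semidirect_bracket brg brh \<phi>) (sum_metric g h)) (map_prod E E')"
      by (rule par[OF linE comm(2) pg(2) ph(2)])
  qed (simp_all add: lin linJ linE split_beta prod_eq_iff sum_metric_def ag ah)
qed

text \<open>The curvature of the product on vectors \<open>(0, a)\<close>, \<open>(0, b)\<close>, \<open>(0, c)\<close> has the curvature of \<open>h\<close> as its
  second component, because the second component of the connection involves \<open>\<hh>\<close> alone.\<close>

lemma flat_semidirect_imp_flat:
  assumes g: "lie_algebra brg" "metric g" and h: "lie_algebra brh" "metric h"
    and r: "rep_by_derivations brg brh \<phi>"
    and skew: "\<And>a x y. g (\<phi> a x) y + g x (\<phi> a y) = 0"
    and flat: "flat_metric (semidirect_bracket brg brh \<phi>) (sum_metric g h)"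
  shows "flat_metric brh h"
  unfolding flat_metric_def
proof (intro allI)
  fix a b c
  let ?br = "semidirect_bracket brg brh \<phi>"
  have "curvature brh (levi_civita brh h) a b c =
      snd (curvature ?br (levi_civita ?br (sum_metric g h)) (0, a) (0, b) (0, c))"
    unfolding curvature_def levi_civita_semidirect[OF g h r, OF skew]
    by (simp add: semidirect_bracket_def)
  then show "curvature brh (levi_civita brh h) a b c = 0"
    using flat unfolding flat_metric_def by simp
qed

lemma lie_algebra_abelian:
  assumes "finite_dim TYPE('a::real_vector)"
  shows "lie_algebra (\<lambda>_ _. 0 :: 'a)"
  using assms by (simp add: lie_algebra_def bilinear_def linear_iff)

text \<open>With the zero bracket the zero connection is metric and torsion free, so every tensor is parallel.\<close>

lemma levi_civita_abelian:
  fixes g :: "'a::real_vector \<Rightarrow> 'a \<Rightarrow> real"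
  assumes "finite_dim TYPE('a)" and "metric g"
  shows "levi_civita (\<lambda>_ _. 0) g = (\<lambda>_ _. 0)"
proof -
  have "bilinear g" using assms(2) unfolding metric_def by blast
  then have "torsion_free_metric_connection (\<lambda>_ _. 0) g (\<lambda>_ _. 0)"
    by (simp add: torsion_free_metric_connection_def bilinear_lins) (simp add: bilinear_def linear_iff)
  then show ?thesis
    by (rule levi_civita_eqI[OF lie_algebra_abelian[OF assms(1)] assms(2)])
qed

lemma flat_metric_abelian:
  fixes g :: "'a::real_vector \<Rightarrow> 'a \<Rightarrow> real"
  assumes "finite_dim TYPE('a)" and "metric g"
  shows "flat_metric (\<lambda>_ _. 0) g"
  by (simp add: flat_metric_def levi_civita_abelian[OF assms] curvature_def)

lemma hypersymplectic_abelian: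
  fixes g :: "'a::real_vector \<Rightarrow> 'a \<Rightarrow> real"
  assumes "finite_dim TYPE('a)" and "metric g" and "linear J" and "linear E"
    and "\<And>x. J (J x) = - x" and "\<And>x. E (E x) = x" and "\<And>x. J (E x) = - E (J x)"
    and "\<And>x y. g (J x) (J y) = g x y" and "\<And>x y. g (E x) (E y) = - g x y"
  shows "hypersymplectic (\<lambda>_ _. 0) g J E"
  using assms
  by (simp add: hypersymplectic_def lie_algebra_abelian levi_civita_abelian parallel_def linear_0)

section \<open>Actions through a linear form\<close>

lemma rep_by_derivations_form:
  assumes c: "linear c" "\<And>a b. c (brh a b) = 0" and N: "linear N"
  shows "rep_by_derivations (\<lambda>_ _. 0) brh (\<lambda>a x. c a *\<^sub>R N x)"
  unfolding rep_by_derivations_def derivation_def bilinear_def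
  by (auto intro!: linearI simp: c(2) linear_add[OF c(1)] linear_cmul[OF c(1)]
      linear_0[OF N] linear_add[OF N] linear_cmul[OF N] algebra_simps)

lemma subspace_lower_central: "subspace (lower_central br i)"
  by (cases i) auto

lemma lower_central_zero_mono:
  assumes "bilinear br" and "lower_central br s = {0}" and "s \<le> k"
  shows "lower_central br k = {0}"
  using assms(3)
proof (induction rule: dec_induct)
  case base then show ?case by (rule assms(2))
next
  case (step i) then show ?case by (simp add: bilinear_lins[OF assms(1)])
qed

text \<open>A bracket of \<open>(x, a)\<close> and \<open>(y, b)\<close> has the first component \<open>c(a) N y - c(b) N x\<close>. Beyond the
  first step \<open>c(b) = 0\<close>, so the arbitrary vector \<open>x\<close> drops out and one more power of \<open>N\<close> is gained.\<close>

lemma lower_central_semidirect_form_upper: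
  assumes c: "linear c" "\<And>a b. c (brh a b) = 0" and N: "linear N"
  shows "lower_central (semidirect_bracket (\<lambda>_ _. 0) brh (\<lambda>a x. c a *\<^sub>R N x)) i
    \<subseteq> range (N ^^ i) \<times> lower_central brh i"
proof (induction i)
  case 0 then show ?case by simp
next
  case (Suc i)
  let ?br = "semidirect_bracket (\<lambda>_ _. 0) brh (\<lambda>a x. c a *\<^sub>R N x)"
  have linP: "linear (N ^^ j)" for j
    by (induction j) (auto simp: linear_iff linear_add[OF N] linear_cmul[OF N])
  have cb: "c b = 0" if "b \<in> lower_central brh (Suc j)" for b j
  proof -
    have "b \<in> span {brh x y |x y. y \<in> lower_central brh j}" using that by simp
    then show ?thesis
      by (induction rule: span_induct)
        (auto simp: subspace_def linear_0[OF c(1)] linear_add[OF c(1)] linear_cmul[OF c(1)] c(2))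
  qed
  have "?br u v \<in> range (N ^^ Suc i) \<times> lower_central brh (Suc i)"
    if v: "v \<in> lower_central ?br i" for u v
  proof -
    obtain x a where u: "u = (x, a)" by (cases u)
    obtain y b where v': "v = (y, b)" by (cases v)
    obtain z where z: "y = (N ^^ i) z" and b: "b \<in> lower_central brh i"
      using Suc.IH v v' by blast
    have "c a *\<^sub>R N y - c b *\<^sub>R N x \<in> range (N ^^ Suc i)"
    proof (cases i)
      case 0
      have "c a *\<^sub>R N y - c b *\<^sub>R N x = N (c a *\<^sub>R y - c b *\<^sub>R x)"
        by (simp add: linear_diff[OF N] linear_cmul[OF N])
      then show ?thesis using 0 by simp
    next
      case (Suc j)
      have "c a *\<^sub>R N y - c b *\<^sub>R N x = (N ^^ Suc i) (c a *\<^sub>R z)"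
        using cb b Suc by (simp add: z linear_cmul[OF linP] linear_cmul[OF N])
      then show ?thesis by blast
    qed
    moreover have "brh a b \<in> lower_central brh (Suc i)"
      using b by (auto intro!: span_base)
    ultimately show ?thesis by (simp add: u v' semidirect_bracket_def)
  qed
  then have "{?br u v |u v. v \<in> lower_central ?br i} \<subseteq> range (N ^^ Suc i) \<times> lower_central brh (Suc i)"
    by blast
  moreover have "subspace (range (N ^^ Suc i) \<times> lower_central brh (Suc i))"
    by (intro subspace_Times subspace_lower_central linear_subspace_image linP subspace_UNIV)
  ultimately have "span {?br u v |u v. v \<in> lower_central ?br i}
      \<subseteq> range (N ^^ Suc i) \<times> lower_central brh (Suc i)"
    by (rule span_minimal)
  then show ?case by (simp only: lower_central.simps)
qed

lemma lower_central_semidirect_form_lower: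
  assumes bh: "bilinear brh" and c: "linear c" "c e = 1"
  shows "((N ^^ i) x, 0) \<in> lower_central (semidirect_bracket (\<lambda>_ _. 0) brh (\<lambda>a x. c a *\<^sub>R N x)) i"
proof (induction i)
  case 0 then show ?case by simp
next
  case (Suc i)
  let ?br = "semidirect_bracket (\<lambda>_ _. 0) brh (\<lambda>a x. c a *\<^sub>R N x)"
  have "((N ^^ Suc i) x, 0) = ?br (0, e) ((N ^^ i) x, 0)"
    by (simp add: semidirect_bracket_def c(2) linear_0[OF c(1)] bilinear_lins[OF bh])
  with Suc.IH show ?case by (auto intro!: span_base)
qed

lemma nilpotent_step_semidirect_form:
  assumes bh: "bilinear brh" and c: "linear c" "\<And>a b. c (brh a b) = 0" "c e = 1"
    and N: "linear N" "\<And>x. (N ^^ k) x = 0" "(N ^^ (k - 1)) x \<noteq> 0"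
    and nil: "nilpotent_step brh s" "s \<le> k"
  shows "nilpotent_step (semidirect_bracket (\<lambda>_ _. 0) brh (\<lambda>a x. c a *\<^sub>R N x)) k"
  unfolding nilpotent_step_def
proof (intro conjI allI impI)
  let ?br = "semidirect_bracket (\<lambda>_ _. 0) brh (\<lambda>a x. c a *\<^sub>R N x)"
  have "lower_central brh k = {0}"
    using nil lower_central_zero_mono[OF bh] unfolding nilpotent_step_def by blast
  moreover have "range (N ^^ k) = {0}" using N(2) by auto
  ultimately have "lower_central ?br k \<subseteq> {0}"
    using lower_central_semidirect_form_upper[of c brh N k, OF c(1,2) N(1)]
    by (auto simp: zero_prod_def)
  then show "lower_central ?br k = {0}"
    using subspace_0[OF subspace_lower_central, of ?br k] by blast
next
  fix i assume "i < k"
  let ?br = "semidirect_bracket (\<lambda>_ _. 0) brh (\<lambda>a x. c a *\<^sub>R N x)"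
  have "(N ^^ (k - 1)) x = (N ^^ (k - 1 - i)) ((N ^^ i) x)"
    using \<open>i < k\<close> funpow_add[of "k - 1 - i" i N] by simp
  moreover have "(N ^^ j) 0 = 0" for j
    by (induction j) (auto simp: linear_0[OF N(1)])
  ultimately have "(N ^^ i) x \<noteq> 0" using N(3) by metis
  then show "lower_central ?br i \<noteq> {0}"
    using lower_central_semidirect_form_lower[where i=i and N=N and x=x, OF bh c(1,3)]
    by (auto simp: zero_prod_def)
qed

text \<open>Abelian type, applied to \<open>e\<close> and \<open>y \<in> \<gg>\<close>, says \<open>N y = c(J' e) N J y\<close>. Using this twice, with
  \<open>J\<^sup>2 = - 1\<close>, gives \<open>N = - c(J' e)\<^sup>2 N\<close>, which a real coefficient cannot satisfy unless \<open>N = 0\<close>.\<close>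

lemma not_abelian_type_semidirect_form:
  assumes J: "\<And>x. J (J x) = - x" and bh: "bilinear brh" and J': "linear J'"
    and c: "linear c" "c e = 1" and N: "linear N" "N x \<noteq> 0"
  shows "\<not> abelian_type (semidirect_bracket (\<lambda>_ _. 0) brh (\<lambda>a x. c a *\<^sub>R N x)) (map_prod J J')"
proof
  assume "abelian_type (semidirect_bracket (\<lambda>_ _. 0) brh (\<lambda>a x. c a *\<^sub>R N x)) (map_prod J J')"
  from this[unfolded abelian_type_def, rule_format, of "(0, e)" "(_, 0)"]
  have eq: "c (J' e) *\<^sub>R N (J y) = N y" for y
    by (simp add: semidirect_bracket_def c(2) linear_0[OF c(1)] linear_0[OF J'])
  have "N x = c (J' e) *\<^sub>R c (J' e) *\<^sub>R N (J (J x))" by (simp only: eq)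
  then have "(1 + c (J' e) * c (J' e)) *\<^sub>R N x = 0"
    by (simp add: J linear_neg[OF N(1)] scaleR_add_left eq_neg_iff_add_eq_0)
  moreover have "1 + c (J' e) * c (J' e) \<noteq> 0"
    by (smt (verit) zero_le_square)
  ultimately show False using N(2) by simp
qed

section \<open>Block matrices and the antidiagonal matrix\<close>

lemma sum_UNIV_Plus:
  "(\<Sum>i\<in>UNIV. f i) = (\<Sum>i\<in>UNIV. f (Inl i)) + (\<Sum>i\<in>UNIV. f (Inr i))"
  for f :: "'a::finite + 'b::finite \<Rightarrow> 'c::comm_monoid_add"
  using sum.Plus[of "UNIV :: 'a set" "UNIV :: 'b set" f] by simp

lemma block4_mult:
  fixes P Q R S P' Q' R' S' :: "_::semiring_1^_^_"
  shows "block4 P Q R S ** block4 P' Q' R' S' =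
    block4 (P ** P' + Q ** R') (P ** Q' + Q ** S') (R ** P' + S ** R') (R ** Q' + S ** S')"
  by (simp add: vec_eq_iff block4_def matrix_matrix_mult_def sum_UNIV_Plus split: sum.split)

lemma transpose_block4:
  "transpose (block4 P Q R S) = block4 (transpose P) (transpose R) (transpose Q) (transpose S)"
  by (simp add: vec_eq_iff block4_def transpose_def split: sum.split)

lemma uminus_block4: "- block4 P Q R S = block4 (- P) (- Q) (- R) (- S)"
  for P Q R S :: "_::ab_group_add^_^_"
  by (simp add: vec_eq_iff block4_def split: sum.split)

lemma block4_add: "block4 P Q R S + block4 P' Q' R' S' = block4 (P + P') (Q + Q') (R + R') (S + S')"
  for P Q R S :: "_::ab_group_add^_^_"
  by (simp add: vec_eq_iff block4_def split: sum.split)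

lemma block4_mat: "block4 (mat x) 0 0 (mat x) = mat x"
  by (auto simp: vec_eq_iff block4_def mat_def split: sum.split)

lemma block4_zero: "block4 0 0 0 0 = 0"
  by (simp add: vec_eq_iff block4_def split: sum.split)

lemma matrix_mult_minus:
  fixes A :: "real^'n^'m" and B :: "real^'k^'n"
  shows "(- A) ** B = - (A ** B)" and "A ** (- B) = - (A ** B)"
  by (simp_all add: vec_eq_iff matrix_matrix_mult_def sum_negf)

lemma transpose_minus: "transpose (- A) = - transpose A" for A :: "real^'n^'m"
  by (simp add: vec_eq_iff transpose_def)

lemma transpose_zero: "transpose 0 = 0"
  by (simp add: vec_eq_iff transpose_def)

lemma matrix_mult_zero:
  fixes A :: "real^'n^'m"
  shows "(0 :: real^'m^'k) ** A = 0" and "A ** (0 :: real^'k^'n) = 0"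
  by (simp_all add: vec_eq_iff matrix_matrix_mult_def)

lemmas block_simps = block4_mult transpose_block4 uminus_block4 block4_add transpose_mat
  matrix_mult_minus transpose_minus transpose_zero matrix_mult_zero

text \<open>The number of elements below \<open>i\<close> is the position of \<open>i\<close>, and positions run through
  \<open>0, \<dots>, n - 1\<close>, each attained once. So \<open>i\<close> and \<open>j\<close> are opposite when their positions add up to
  \<open>n - 1\<close>, which is a symmetric relation pairing each index with exactly one other.\<close>

lemma bij_betw_card_less:
  "bij_betw (\<lambda>i::'n::{finite,linorder}. card {k. k < i}) UNIV {..<CARD('n)}"
proof -
  let ?r = "\<lambda>i::'n. card {k. k < i}"
  have "strict_mono ?r"
  proof (rule strict_monoI)
    fix i j :: 'n assume "i < j"
    then have "{k. k < i} \<subset> {k. k < j}" by auto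
    then show "?r i < ?r j" by (simp add: psubset_card_mono)
  qed
  then have inj: "inj ?r" by (rule strict_mono_imp_inj_on)
  have "?r i < CARD('n)" for i
    by (rule psubset_card_mono) auto
  then have sub: "range ?r \<subseteq> {..<CARD('n)}" by auto
  have "card (range ?r) = CARD('n)" by (rule card_image[OF inj])
  then have "range ?r = {..<CARD('n)}"
    by (intro card_subset_eq[OF _ sub]) simp_all
  with inj show ?thesis by (simp add: bij_betw_def)
qed

lemma opposite_iff:
  fixes i j :: "'n::{finite,linorder}"
  shows "card {k. k < i} = card {k. j < k} \<longleftrightarrow> card {k. k < i} + card {k. k < j} + 1 = CARD('n)"
proof -
  have "UNIV = {k. k < j} \<union> insert j {k. j < k}" by auto
  then have "CARD('n) = card ({k. k < j} \<union> insert j {k. j < k})" by simp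
  also have "\<dots> = card {k. k < j} + card (insert j {k. j < k})"
    by (rule card_Un_disjoint) auto
  also have "\<dots> = card {k. k < j} + 1 + card {k. j < k}" by simp
  finally show ?thesis by linarith
qed

lemma transpose_antidiag: "transpose antidiag = antidiag"
  unfolding antidiag_def transpose_def vec_eq_iff opposite_iff by (simp add: add.commute)

lemma antidiag_square:
  "antidiag ** antidiag = (mat 1 :: real^('n::{finite,linorder})^('n::{finite,linorder}))"
proof -
  let ?r = "\<lambda>i::'n. card {k. k < i}"
  have "\<exists>j. ?r i + ?r j + 1 = CARD('n)" for i
  proof -
    have "?r i < CARD('n)" using bij_betw_apply[OF bij_betw_card_less, of i] by simp
    then have "CARD('n) - 1 - ?r i \<in> {..<CARD('n)}" by auto
    then have "CARD('n) - 1 - ?r i \<in> range ?r"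
      unfolding bij_betw_imp_surj_on[OF bij_betw_card_less] .
    then obtain j where "CARD('n) - 1 - ?r i = ?r j" by (rule imageE) (rule that)
    then have "?r i + ?r j + 1 = CARD('n)" using \<open>?r i < CARD('n)\<close> by linarith
    then show ?thesis ..
  qed
  then obtain \<sigma> where \<sigma>: "\<And>i. ?r i + ?r (\<sigma> i) + 1 = CARD('n)" by metis
  have inj: "?r i = ?r j \<longleftrightarrow> i = j" for i j
    using bij_betw_imp_inj_on[OF bij_betw_card_less] by (auto dest: injD)
  have opp: "?r i + ?r j + 1 = CARD('n) \<longleftrightarrow> j = \<sigma> i" for i j
    using \<sigma>[of i] inj[of j "\<sigma> i"] by linarith
  have inv: "j = \<sigma> (\<sigma> i) \<longleftrightarrow> i = j" for i j
    using opp[of "\<sigma> i" j] opp[of "\<sigma> i" i] \<sigma>[of i] by auto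
  have a: "antidiag $ i $ j = (if j = \<sigma> i then 1 else 0)" for i j :: 'n
    by (simp only: antidiag_def vec_lambda_beta opposite_iff opp)
  show ?thesis
    by (simp add: vec_eq_iff matrix_matrix_mult_def a mat_def inv if_distrib[of "\<lambda>x. x * _"]
        cong: if_cong)
qed

section \<open>The flat hypersymplectic structure and the skew matrix\<close>

lemma form_of_mult: "form_of G (M *v x) (M' *v y) = form_of (transpose M ** G ** M') x y"
  unfolding form_of_def matrix_vector_mul_assoc[symmetric]
  by (simp only: dot_lmul_matrix[symmetric, of x "transpose M"] vector_transpose_matrix)

lemma bilinear_form_of: "bilinear (form_of G)"
  by (simp add: bilinear_def linear_iff form_of_def inner_add_left inner_add_right
      matrix_vector_right_distrib matrix_vector_mult_scaleR)

lemma matrix_vector_minus: "(- M) *v x = - (M *v x)" for M :: "real^'n^'m"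
  by (simp add: vec_eq_iff matrix_vector_mult_def sum_negf)

lemma form_of_neg: "form_of (- G) x y = - form_of G x y"
  by (simp add: form_of_def matrix_vector_minus)

lemma metric_form_of:
  assumes "transpose G = G" and "G' ** G = mat 1"
  shows "metric (form_of G)"
  unfolding metric_def
proof (intro conjI allI impI bilinear_form_of)
  show sym: "form_of G x y = form_of G y x" for x y
    unfolding form_of_def
    by (metis assms(1) dot_lmul_matrix inner_commute transpose_matrix_vector)
  fix x assume "\<forall>y. form_of G x y = 0"
  then have "y \<bullet> (G *v x) = 0" for y using sym unfolding form_of_def by metis
  then have "G *v x = 0" using inner_eq_zero_iff by blast
  then have "G' *v (G *v x) = 0" by simp
  then show "x = 0" using assms(2) by (simp add: matrix_vector_mul_assoc)
qed

lemma g_mat_sym: "transpose g_mat = g_mat"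
  by (simp add: g_mat_def block_simps transpose_antidiag)

lemma g_mat_square: "g_mat ** g_mat = mat 1"
  by (simp add: g_mat_def block_simps antidiag_square block4_mat)

lemma J_mat_square: "J_mat ** J_mat = - mat 1"
  by (simp add: J_mat_def block_simps block4_mat[symmetric])

lemma E_mat_square: "E_mat ** E_mat = mat 1"
  by (simp add: E_mat_def block_simps block4_mat)

lemma J_mat_E_mat: "J_mat ** E_mat = - (E_mat ** J_mat)"
  by (simp add: J_mat_def E_mat_def block_simps)

lemma J_mat_g_mat: "transpose J_mat ** g_mat ** J_mat = g_mat"
  by (simp add: J_mat_def g_mat_def block_simps)

lemma E_mat_g_mat: "transpose E_mat ** g_mat ** E_mat = - g_mat"
  by (simp add: E_mat_def g_mat_def block_simps)

lemma N_mat_J_mat: "N_mat A ** J_mat = J_mat ** N_mat A"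
  by (simp add: J_mat_def N_mat_def Let_def block_simps)

lemma N_mat_E_mat: "N_mat A ** E_mat = E_mat ** N_mat A"
  by (simp add: E_mat_def N_mat_def Let_def block_simps)

text \<open>The lower diagonal block of \<open>N\<close> is minus the adjoint of the upper one, and \<open>g\<close> pairs the two
  with each other; \<open>I\<^sup>2 = 1\<close> makes the contributions cancel.\<close>

lemma N_mat_skew: "transpose (N_mat A) ** g_mat + g_mat ** N_mat A = 0"
  by (simp add: g_mat_def N_mat_def Let_def block_simps matrix_transpose_mul transpose_antidiag
      matrix_mul_assoc antidiag_square block4_zero)
    (simp add: matrix_mul_assoc[symmetric] antidiag_square block4_zero)

lemma form_of_N_mat_skew:
  "form_of g_mat (N_mat A *v x) y + form_of g_mat x (N_mat A *v y) = 0"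
proof -
  have "form_of g_mat (N_mat A *v x) y + form_of g_mat x (N_mat A *v y) =
      form_of (transpose (N_mat A) ** g_mat + g_mat ** N_mat A) x y"
    using form_of_mult[of g_mat "N_mat A" x "mat 1" y] form_of_mult[of g_mat "mat 1" x "N_mat A" y]
    by (simp add: form_of_def matrix_vector_mult_add_rdistrib inner_add_right transpose_mat)
  then show ?thesis by (simp add: N_mat_skew form_of_def)
qed

lemma metric_g_mat: "metric (form_of g_mat)"
  by (rule metric_form_of[OF g_mat_sym g_mat_square])

lemma hypersymplectic_model:
  "hypersymplectic (\<lambda>_ _. 0) (form_of g_mat) ((*v) J_mat) ((*v) E_mat)"
  by (rule hypersymplectic_abelian)
    (simp_all add: finite_dim_euclidean metric_g_mat matrix_vector_mul_assoc J_mat_square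
      E_mat_square J_mat_E_mat form_of_mult J_mat_g_mat E_mat_g_mat form_of_neg matrix_vector_minus)

section \<open>Powers of the acting matrix\<close>

lemma mat_pow_funpow: "mat_pow M k *v x = (((*v) M) ^^ k) x"
  by (induction k) (simp_all add: matrix_vector_mul_assoc[symmetric])

lemma mat_pow_Suc_right: "mat_pow M (Suc k) = mat_pow M k ** M"
proof (induction k)
  case (Suc k)
  have "mat_pow M (Suc (Suc k)) = M ** (mat_pow M k ** M)"
    by (simp only: mat_pow.simps(2)[of M "Suc k"] Suc.IH)
  also have "\<dots> = mat_pow M (Suc k) ** M" by (simp add: matrix_mul_assoc)
  finally show ?case .
qed simp

lemma mat_pow_block4: "mat_pow (block4 P 0 0 Q) k = block4 (mat_pow P k) 0 0 (mat_pow Q k)"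
  by (induction k) (simp_all add: block4_mat block_simps)

text \<open>Taking adjoints reverses products, but the factors of a power are all equal, so the power of the
  adjoint is the adjoint of the power; the involution \<open>S\<close> cancels between neighbouring factors.\<close>

lemma mat_pow_neg_adjoint_eq_0:
  assumes S: "S ** S = mat 1" and "mat_pow A k = 0"
  shows "mat_pow (- (S ** transpose A ** S)) k = 0"
proof -
  have "mat_pow (- (S ** transpose A ** S)) j = S ** transpose (mat_pow (- A) j) ** S" for j
  proof (induction j)
    case 0 then show ?case by (simp add: S transpose_mat)
  next
    case (Suc j)
    have "mat_pow (- (S ** transpose A ** S)) (Suc j)
        = - (S ** transpose A ** (S ** S) ** transpose (mat_pow (- A) j) ** S)"
      by (simp add: Suc.IH matrix_mult_minus matrix_mul_assoc)
    also have "\<dots> = S ** transpose (mat_pow (- A) (Suc j)) ** S"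
      unfolding mat_pow_Suc_right
      by (simp add: S matrix_transpose_mul transpose_minus matrix_mult_minus matrix_mul_assoc)
    finally show ?case .
  qed
  moreover have "mat_pow (- A) j = mat_pow A j \<or> mat_pow (- A) j = - mat_pow A j" for j
    by (induction j) (auto simp: matrix_mult_minus)
  ultimately show ?thesis
    using assms(2) by (metis matrix_mult_zero minus_zero transpose_zero)
qed

lemma mat_pow_N_mat_eq_0_iff: "mat_pow (N_mat A) k = 0 \<longleftrightarrow> mat_pow A k = 0"
proof
  assume "mat_pow A k = 0"
  then show "mat_pow (N_mat A) k = 0"
    by (simp add: N_mat_def Let_def mat_pow_block4 mat_pow_neg_adjoint_eq_0 antidiag_square block4_zero)
next
  assume "mat_pow (N_mat A) k = 0"
  then have "mat_pow (N_mat A) k $ Inl (Inl i) $ Inl (Inl j) = 0" for i j by simp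
  then show "mat_pow A k = 0"
    by (simp add: N_mat_def Let_def mat_pow_block4 vec_eq_iff) (simp add: block4_def)
qed

section \<open>The twisted product\<close>

text \<open>This turns a map that is prescribed on a basis into a form times a fixed operator, so that no
  coordinates of \<open>\<hh>\<close> are needed afterwards. The coefficient is unique because \<open>N\<close> is nonzero, and
  uniqueness makes it linear.\<close>

lemma linear_rank_one_form:
  assumes \<Phi>: "linear \<Phi>" "\<And>x. x \<in> S \<Longrightarrow> \<Phi> x \<in> span {N}" and S: "span S = UNIV" and N: "N \<noteq> 0"
  obtains c :: "_ \<Rightarrow> real" where "linear c" and "\<And>x. \<Phi> x = c x *\<^sub>R N"
proof -
  have "\<Phi> ` UNIV \<subseteq> span {N}"
    unfolding S[symmetric] linear_span_image[OF \<Phi>(1), symmetric]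
    using \<Phi>(2) by (intro span_minimal) auto
  then have "\<exists>r. \<Phi> x = r *\<^sub>R N" for x by (auto simp: span_singleton)
  then obtain c where c: "\<And>x. \<Phi> x = c x *\<^sub>R N" by metis
  have "linear c"
  proof (rule linearI)
    fix x y r
    have "c (x + y) *\<^sub>R N = (c x + c y) *\<^sub>R N"
      by (simp add: c[symmetric] linear_add[OF \<Phi>(1)] scaleR_add_left)
    then show "c (x + y) = c x + c y" using N by (simp only: scaleR_cancel_right) simp
    have "c (r *\<^sub>R x) *\<^sub>R N = (r *\<^sub>R c x) *\<^sub>R N"
      by (simp add: c[symmetric] linear_cmul[OF \<Phi>(1)] flip: scaleR_scaleR)
    then show "c (r *\<^sub>R x) = r *\<^sub>R c x" using N by (simp only: scaleR_cancel_right) simp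
  qed
  with c that show thesis by blast
qed

theorem proposition4p25:
  fixes A :: "real^('n::{finite,linorder})^('n::{finite,linorder})"
    and brh :: "'b::real_vector \<Rightarrow> 'b \<Rightarrow> 'b"
    and h :: "'b \<Rightarrow> 'b \<Rightarrow> real"
    and Jh Eh :: "'b \<Rightarrow> 'b"
    and s k m :: nat
    and a :: "nat \<Rightarrow> 'b"
    and \<Phi> :: "'b \<Rightarrow> real^('n quad)^('n quad)"
  assumes hyp_h: "hypersymplectic brh h Jh Eh"
    and nil_h: "nilpotent_step brh s"
    and k: "s \<le> k" "k \<le> CARD('n)" "k \<ge> 2"
    and A: "mat_pow A k = 0" "mat_pow A (k - 1) \<noteq> 0"
    and basis: "1 \<le> m" "inj_on a {1..m}" "independent (a ` {1..m})" "span (a ` {1..m}) = UNIV"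
    and derived: "span {brh x y | x y. True} \<subseteq> span (a ` {2..m})"
    and \<Phi>: "linear \<Phi>" "\<Phi> (a 1) = N_mat A" "\<forall>j\<in>{2..m}. \<Phi> (a j) = 0"
  shows "let brg = (\<lambda>_ _. 0 :: real^('n quad));
             g = form_of (g_mat :: real^('n quad)^('n quad));
             Jg = (*v) (J_mat :: real^('n quad)^('n quad));
             Eg = (*v) (E_mat :: real^('n quad)^('n quad));
             \<phi> = (\<lambda>x. (*v) (\<Phi> x));
             br = semidirect_bracket brg brh \<phi>;
             gt = sum_metric g h;
             Jt = map_prod Jg Jh;
             Et = map_prod Eg Eh
         in hypersymplectic brg g Jg Eg \<and> flat_metric brg g \<and>
            rep_by_derivations brg brh \<phi> \<and>
            hypersymplectic br gt Jt Et \<and> nilpotent_step br k \<and> \<not> abelian_type br Jt \<and>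
            (\<not> flat_metric brh h \<longrightarrow> \<not> flat_metric br gt)"
proof -
  let ?g = "form_of (g_mat :: real^('n quad)^('n quad))"
  let ?N = "(*v) (N_mat A)"
  have "mat_pow A 1 \<noteq> 0"
  proof
    assume "mat_pow A 1 = 0"
    then have "A = 0" by simp
    moreover obtain j where "k - 1 = Suc j" using k(3) by (cases "k - 1") auto
    ultimately show False using A(2) by (simp add: matrix_mult_zero)
  qed
  then have N0: "N_mat A \<noteq> 0" using mat_pow_N_mat_eq_0_iff[of A 1] by auto
  have split: "{1..m} = insert 1 {2..m}" using basis(1) by auto
  have "\<Phi> x \<in> span {N_mat A}" if "x \<in> a ` {1..m}" for x
    using that \<Phi>(2,3) unfolding split by (auto intro: span_base span_zero)
  from linear_rank_one_form[OF \<Phi>(1) this basis(4) N0]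
  obtain c where c: "linear c" and \<Phi>c: "\<And>x. \<Phi> x = c x *\<^sub>R N_mat A" by metis
  have c1: "c (a 1) = 1"
  proof -
    have "c (a 1) *\<^sub>R N_mat A = 1 *\<^sub>R N_mat A"
      using \<Phi>c[of "a 1"] \<Phi>(2) by simp
    then show ?thesis using N0 by (simp only: scaleR_cancel_right) simp
  qed
  have c0: "c (brh x y) = 0" for x y
  proof -
    have "brh x y \<in> span (a ` {2..m})" using derived by (blast intro: span_base)
    then have "\<Phi> (brh x y) = 0"
      using linear_eq_0_on_span[OF \<Phi>(1)] \<Phi>(3) by blast
    then show ?thesis using \<Phi>c N0 by simp
  qed
  have \<phi>: "(\<lambda>x. (*v) (\<Phi> x)) = (\<lambda>x v. c x *\<^sub>R ?N v)"
    by (intro ext) (simp add: \<Phi>c scaleR_matrix_vector_assoc)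
  have linN: "linear ?N" by simp
  have rep: "rep_by_derivations (\<lambda>_ _. 0) brh (\<lambda>x v. c x *\<^sub>R ?N v)"
    by (rule rep_by_derivations_form[OF c c0 linN])
  have skew: "?g (c x *\<^sub>R ?N v) w + ?g v (c x *\<^sub>R ?N w) = 0" for x v w
    using form_of_N_mat_skew[of A v w]
    by (simp add: bilinear_lins[OF bilinear_form_of] flip: distrib_left)
  have L: "lie_algebra brh" "metric h" "linear Jh"
    using hyp_h unfolding hypersymplectic_def by blast+
  have bh: "bilinear brh" using L(1) unfolding lie_algebra_def by blast
  have M: "lie_algebra (\<lambda>_ _. 0 :: real^('n quad))" "metric ?g"
    using hypersymplectic_model unfolding hypersymplectic_def by blast+
  have hyp: "hypersymplectic (semidirect_bracket (\<lambda>_ _. 0) brh (\<lambda>x v. c x *\<^sub>R ?N v))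
      (sum_metric ?g h) (map_prod ((*v) J_mat) Jh) (map_prod ((*v) E_mat) Eh)"
    by (rule hypersymplectic_semidirect[OF hypersymplectic_model hyp_h rep, OF skew])
      (simp_all add: matrix_vector_mul_assoc N_mat_J_mat N_mat_E_mat matrix_vector_mult_scaleR)
  have nonzero: "\<exists>x. M *v x \<noteq> 0" if "M \<noteq> 0" for M :: "real^('n quad)^('n quad)"
    using that by (metis matrix_eq matrix_vector_mult_0)
  have Nk: "(?N ^^ k) x = 0" for x
    using A(1) by (simp add: mat_pow_funpow[symmetric] mat_pow_N_mat_eq_0_iff[THEN iffD2])
  obtain x where x: "(?N ^^ (k - 1)) x \<noteq> 0"
    using nonzero[of "mat_pow (N_mat A) (k - 1)"] A(2)
    by (auto simp: mat_pow_funpow mat_pow_N_mat_eq_0_iff)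
  have nil: "nilpotent_step (semidirect_bracket (\<lambda>_ _. 0) brh (\<lambda>x v. c x *\<^sub>R ?N v)) k"
    by (rule nilpotent_step_semidirect_form[OF bh c c0 c1 linN Nk x nil_h k(1)])
  obtain y where y: "?N y \<noteq> 0" using nonzero[OF N0] by blast
  have "J_mat *v (J_mat *v z) = - z" for z :: "real^('n quad)"
    using hypersymplectic_model unfolding hypersymplectic_def by blast
  then have nab: "\<not> abelian_type (semidirect_bracket (\<lambda>_ _. 0) brh (\<lambda>x v. c x *\<^sub>R ?N v))
      (map_prod ((*v) J_mat) Jh)"
    by (rule not_abelian_type_semidirect_form[OF _ bh L(3) c c1 linN y])
  have "flat_metric brh h"
    if "flat_metric (semidirect_bracket (\<lambda>_ _. 0) brh (\<lambda>x v. c x *\<^sub>R ?N v)) (sum_metric ?g h)"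
    by (rule flat_semidirect_imp_flat[OF M L(1,2) rep, OF skew that])
  then have nonflat: "\<not> flat_metric brh h \<longrightarrow>
      \<not> flat_metric (semidirect_bracket (\<lambda>_ _. 0) brh (\<lambda>x v. c x *\<^sub>R ?N v)) (sum_metric ?g h)"
    by iprover
  show ?thesis
    unfolding Let_def \<phi>
    by (intro conjI hypersymplectic_model flat_metric_abelian[OF finite_dim_euclidean M(2)] rep
        hyp nil nab nonflat)
qed

end
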